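(* Let $C_0 = \left\{\sum_{n=2}^{\infty} \frac{d_n}{n!} : d_n \in\{0,1,\dots,n-2\} \text{ for all } n\ge 2 \right\}\subset\mathbb{R}$. For every perfect set $P\subset\mathbb{R}$ there exists $x\in\mathbb{R}$ such that $(C_0+x)\cap P$ is uncountable.
   Context: A perfect set $P\subset\mathbb{R}$ is a nonempty closed set without isolated points. For $x\in\mathbb{R}$, $C_0+x=\{c+x : c\in C_0\}$ is the translate of $C_0$ by $x$. The result is a theorem of ZFC. *)

theory Defs
  imports "HOL-Analysis.Analysis"
begin

text \<open>The series over \<open>n \<ge> 2\<close> is indexed from \<open>0\<close> by a shift by \<open>2\<close>; only the values
  \<open>d n\<close> with \<open>n \<ge> 2\<close> matter, and there \<open>n - 2\<close> does not truncate.\<close>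

definition C0 :: "real set" where
  "C0 = {(\<Sum>n. real (d (n + 2)) / fact (n + 2)) | d :: nat \<Rightarrow> nat. \<forall>n\<ge>2. d n \<in> {0..n - 2}}"

text \<open>All series in \<^const>\<open>C0\<close> converge, so the default value of \<^const>\<open>suminf\<close> plays no role.\<close>

lemma C0_summable:
  fixes d :: "nat \<Rightarrow> nat"
  assumes "\<forall>n\<ge>2. d n \<in> {0..n - 2}"
  shows "summable (\<lambda>n. real (d (n + 2)) / fact (n + 2))"
proof (rule summable_comparison_test')
  show "summable (\<lambda>n. 1 / fact n :: real)"
    using summable_exp[of "1::real"] by (simp add: inverse_eq_divide)
  fix n :: nat
  have "d (n + 2) \<le> n + 2"
    using assms[rule_format, of "n + 2"] by simp
  then have "real (d (n + 2)) / fact (n + 2) \<le> real (n + 2) / fact (n + 2)"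
    by (intro divide_right_mono of_nat_mono fact_ge_zero)
  also have "\<dots> = 1 / fact (n + 1)"
  proof -
    have "fact (n + 2) = real (n + 2) * fact (n + 1)"
      using fact_Suc[of "n + 1", where 'a = real] by (simp only: add_2_eq_Suc' Suc_eq_plus1[symmetric])
    then show ?thesis
      by (simp only: nonzero_divide_eq_eq) (simp del: fact_Suc)
  qed
  also have "\<dots> \<le> 1 / fact n"
    by (intro divide_left_mono fact_mono) simp_all
  finally show "norm (real (d (n + 2)) / fact (n + 2)) \<le> 1 / fact n"
    by simp
qed

definition perfect_set :: "real set \<Rightarrow> bool" where
  "perfect_set P \<longleftrightarrow> P \<noteq> {} \<and> closed P \<and> \<not> (\<exists>x. x isolated_in P)"

end

theory Submission
  imports Defs "HOL-Library.Nat_Bijection"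
begin

text \<open>
  For \<open>y\<close> in \<open>[0, 1)\<close> the factorial-base digits are \<open>d n = \<lfloor>n! y\<rfloor> mod n \<in> {0..n - 1}\<close>, and \<open>y\<close> lies
  in \<^const>\<open>C0\<close> as soon as no digit takes its top value \<open>n - 1\<close> (\<open>mem_C0_if_digits\<close>). At level \<open>n\<close>
  only one residue out of \<open>n\<close> is forbidden, so a set that looks like far fewer than \<open>n\<close> points at scale
  \<open>1 / n!\<close> can be moved by a multiple of \<open>1 / n!\<close> so that all its points avoid the forbidden digit:
  each point, even when it is blurred by \<open>1 / n!\<close> and the translation is left undetermined within
  \<open>2 / n!\<close>, rules out at most five of the \<open>n\<close> shifts (\<open>refine_interval\<close>). The leftover freedom
  \<open>2 / n!\<close> in the translation accommodates the choice at level \<open>n + 1\<close>, and nested intervals give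
  a single translation that works at all levels (\<open>thin_set_in_translate_C0\<close>).

  Hence every set that is covered, for each \<open>n \<ge> 6\<close>, by fewer than \<open>n / 5\<close> balls of radius
  \<open>1 / n!\<close> fits into a translate of \<^const>\<open>C0\<close>. Every perfect set contains an uncountable set
  as thin as that: a perfect subset can be grown by adding one point at a time, each extremely close
  to an earlier one, so that the number of visible points grows as slowly as desired compared to the scale
  (\<open>thin_perfect_subset\<close>).
\<close>

section \<open>Factorial-base digits\<close>

text \<open>Since \<open>\<lfloor>(n - 1)! y\<rfloor> = \<lfloor>n! y\<rfloor> div n\<close>, the digits \<open>\<lfloor>n! y\<rfloor> mod n\<close> have the
  truncations \<open>\<lfloor>n! y\<rfloor> / n!\<close> as their partial sums, and these tend to \<open>y\<close>.\<close>

lemma mem_C0_if_digits: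
  fixes y :: real
  assumes y: "0 \<le> y" "y < 1"
    and digits: "\<And>n. n \<ge> 2 \<Longrightarrow> \<lfloor>fact n * y\<rfloor> mod int n \<noteq> int n - 1"
  shows "y \<in> C0"
proof -
  define d where "d n = nat (\<lfloor>fact n * y\<rfloor> mod int n)" for n
  define A where "A n = real_of_int \<lfloor>fact n * y\<rfloor> / fact n" for n
  have d_range: "d n \<in> {0..n - 2}" if "n \<ge> 2" for n
  proof -
    have "\<lfloor>fact n * y\<rfloor> mod int n < int n" "0 \<le> \<lfloor>fact n * y\<rfloor> mod int n"
      using that by simp_all
    with digits[OF that] that show ?thesis
      unfolding d_def by auto
  qed
  have A_step: "A (Suc n) = A n + real (d (Suc n)) / fact (Suc n)" for n
  proof -
    let ?v = "\<lfloor>fact (Suc n) * y\<rfloor>"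
    have "fact n * y = (fact (Suc n) * y) / real_of_int (int (Suc n))"
      by (simp add: field_simps del: of_nat_Suc)
    then have "\<lfloor>fact n * y\<rfloor> = ?v div int (Suc n)"
      by (metis floor_divide_real_eq_div of_nat_0_le_iff)
    then have "?v = int (Suc n) * \<lfloor>fact n * y\<rfloor> + ?v mod int (Suc n)"
      by (metis mult_div_mod_eq)
    moreover have "int (d (Suc n)) = ?v mod int (Suc n)"
      by (simp add: d_def)
    ultimately have "?v = int (Suc n) * \<lfloor>fact n * y\<rfloor> + int (d (Suc n))"
      by simp
    then have "real_of_int ?v = real (Suc n) * real_of_int \<lfloor>fact n * y\<rfloor> + real (d (Suc n))"
      by (metis of_int_add of_int_mult of_int_of_nat_eq)
    then show ?thesis
      unfolding A_def by (simp add: add_divide_distrib del: of_nat_Suc)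
  qed
  have partial: "(\<Sum>k<N. real (d (k + 2)) / fact (k + 2)) = A (Suc N)" for N
  proof (induction N)
    case 0
    have "\<lfloor>y\<rfloor> = 0" using y by linarith
    then show ?case by (simp add: A_def)
  next
    case (Suc N)
    then show ?case using A_step[of "Suc N"] by simp
  qed
  have "(\<lambda>n. inverse (fact n :: real)) \<longlonglongrightarrow> 0"
    using summable_LIMSEQ_zero[OF summable_exp[of "1::real"]] by simp
  then have lower: "(\<lambda>n. y - inverse (fact n)) \<longlonglongrightarrow> y"
    using tendsto_diff[OF tendsto_const[of y]] by fastforce
  have "A \<longlonglongrightarrow> y"
  proof (rule tendsto_sandwich[OF _ _ lower tendsto_const])
    have "y - inverse (fact n) \<le> A n" for n
    proof -
      have "fact n * y - 1 \<le> real_of_int \<lfloor>fact n * y\<rfloor>" by linarith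
      then have "(fact n * y - 1) / fact n \<le> A n"
        unfolding A_def by (rule divide_right_mono) simp
      then show ?thesis by (simp add: diff_divide_distrib inverse_eq_divide)
    qed
    then show "\<forall>\<^sub>F n in sequentially. y - inverse (fact n) \<le> A n" by simp
    have "A n \<le> y" for n
    proof -
      have "real_of_int \<lfloor>fact n * y\<rfloor> \<le> fact n * y" by linarith
      then show ?thesis by (simp add: A_def field_simps)
    qed
    then show "\<forall>\<^sub>F n in sequentially. A n \<le> y" by simp
  qed
  then have "(\<lambda>N. A (Suc N)) \<longlonglongrightarrow> y" by (rule LIMSEQ_Suc)
  then have "(\<lambda>k. real (d (k + 2)) / fact (k + 2)) sums y"
    unfolding sums_def partial .
  then have "y = (\<Sum>k. real (d (k + 2)) / fact (k + 2))" by (rule sums_unique)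
  with d_range show ?thesis unfolding C0_def by blast
qed

section \<open>Choosing the translation\<close>

text \<open>A pair \<open>(w, i)\<close> forbids just one shift \<open>j\<close>, namely the residue of \<open>w - i + 1\<close>. The five values
  of \<open>i\<close> are the possible integer errors in the application: the scaled blurring lies in \<open>[-1, 1]\<close>,
  the scaled freedom of the translation in \<open>[0, 2]\<close>, and rounding down \<open>w\<close> loses less than one.\<close>

lemma avoid_forbidden_residues:
  fixes W :: "int set" and n :: nat
  assumes "finite W" "5 * card W < n"
  shows "\<exists>j<n. \<forall>w\<in>W. \<forall>i\<in>{-1..3}. (w - int j - i) mod int n \<noteq> int n - 1"
proof -
  define bad where "bad = (\<lambda>(w, i). nat ((w - i + 1) mod int n)) ` (W \<times> {-1..3::int})"
  have "card bad \<le> card (W \<times> {-1..3::int})"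
    unfolding bad_def using assms by (intro card_image_le) auto
  also have "\<dots> < card {..<n}"
    using assms by (simp add: card_cartesian_product)
  finally have "\<not> {..<n} \<subseteq> bad"
    using card_mono[of bad "{..<n}"] assms unfolding bad_def by fastforce
  then obtain j where j: "j < n" "j \<notin> bad" by auto
  have "(w - int j - i) mod int n \<noteq> int n - 1" if "w \<in> W" "i \<in> {-1..3}" for w i
  proof
    assume "(w - int j - i) mod int n = int n - 1"
    then have "(w - int j - i) mod int n = (- 1) mod int n"
      using j by (simp add: zmod_minus1)
    then have "(w - int j - i + (int j + 1)) mod int n = (- 1 + (int j + 1)) mod int n"
      by (rule mod_add_cong) (rule refl)
    then have "(w - i + 1) mod int n = int j"
      using j by (simp add: algebra_simps)
    then have "j = (\<lambda>(w, i). nat ((w - i + 1) mod int n)) (w, i)" by simp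
    then have "j \<in> bad" unfolding bad_def using that by blast
    with j show False by simp
  qed
  with j show ?thesis by blast
qed

definition avoids_top_digit :: "nat \<Rightarrow> real set \<Rightarrow> real \<Rightarrow> bool" where
  "avoids_top_digit n Q x \<longleftrightarrow> (\<forall>q\<in>Q. \<lfloor>fact n * (q - x)\<rfloor> mod int n \<noteq> int n - 1)"

text \<open>One step of the nested intervals. The shifted interval stays inside the given one because
  \<open>j + 2 \<le> 2 n\<close> for every shift \<open>j < n\<close>, and \<open>2 / (n - 1)! = 2 n / n!\<close>; this is why the length
  \<open>2 / n!\<close> rather than \<open>1 / n!\<close> can be kept at every level.\<close>

lemma refine_interval:
  fixes a :: real
  assumes n: "0 < n" and F: "finite F" "5 * card F < n" and Q: "Q \<subseteq> (\<Union>p\<in>F. cball p (1 / fact n))"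
  shows "\<exists>a'. {a'..a' + 2 / fact n} \<subseteq> {a..a + 2 / fact (n - 1)}
    \<and> (\<forall>x\<in>{a'..a' + 2 / fact n}. avoids_top_digit n Q x)"
proof -
  define W where "W = (\<lambda>p. \<lfloor>fact n * (p - a)\<rfloor>) ` F"
  have "card W \<le> card F" unfolding W_def by (rule card_image_le[OF F(1)])
  then have "finite W" "5 * card W < n" using F by (auto simp: W_def)
  from avoid_forbidden_residues[OF this] obtain j where j: "j < n"
    and good: "\<And>w i. w \<in> W \<Longrightarrow> i \<in> {-1..3} \<Longrightarrow> (w - int j - i) mod int n \<noteq> int n - 1"
    by blast
  define a' where "a' = a + real j / fact n"
  have fn: "(fact n :: real) = real n * fact (n - 1)"
    using n by (simp add: fact_reduce)
  have "real j + 2 \<le> 2 * real n" using j by linarith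
  then have "(real j + 2) / fact n \<le> (2 * real n) / fact n"
    by (rule divide_right_mono) simp
  also have "\<dots> = 2 / fact (n - 1)" unfolding fn using n by simp
  finally have "{a'..a' + 2 / fact n} \<subseteq> {a..a + 2 / fact (n - 1)}"
    unfolding a'_def by (auto simp: add_divide_distrib intro: order_trans[of _ "a + real j / fact n"])
  moreover have "avoids_top_digit n Q x" if x: "x \<in> {a'..a' + 2 / fact n}" for x
    unfolding avoids_top_digit_def
  proof
    fix q assume "q \<in> Q"
    then obtain p where p: "p \<in> F" "\<bar>p - q\<bar> \<le> 1 / fact n"
      using Q by (auto simp: dist_real_def)
    \<comment> \<open>In units of \<open>1 / n!\<close>: \<open>\<theta>\<close> is the position of \<open>x\<close> in its interval, \<open>\<eta>\<close> the offset of \<open>q\<close> from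
      the centre of its ball.\<close>
    define w where "w = \<lfloor>fact n * (p - a)\<rfloor>"
    define \<theta> where "\<theta> = fact n * (x - a')"
    define \<eta> where "\<eta> = fact n * (q - p)"
    have "x - a' \<le> 2 / fact n" "0 \<le> x - a'" using x by auto
    then have \<theta>: "0 \<le> \<theta>" "\<theta> \<le> 2"
      unfolding \<theta>_def by (simp_all add: field_simps)
    have "q - p \<le> 1 / fact n" "- (q - p) \<le> 1 / fact n" using p(2) by auto
    then have \<eta>: "-1 \<le> \<eta>" "\<eta> \<le> 1"
      unfolding \<eta>_def by (simp_all add: field_simps)
    have "fact n * (q - x) = fact n * (p - a) + \<eta> - real j - \<theta>"
      unfolding \<theta>_def \<eta>_def a'_def by (simp add: field_simps)
    then have "w - int j - 3 \<le> \<lfloor>fact n * (q - x)\<rfloor>" "\<lfloor>fact n * (q - x)\<rfloor> \<le> w - int j + 1"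
      using \<theta> \<eta> unfolding w_def by linarith+
    then have "w - int j - \<lfloor>fact n * (q - x)\<rfloor> \<in> {-1..3}" by auto
    moreover have "w \<in> W" using p(1) by (auto simp: w_def W_def)
    ultimately show "\<lfloor>fact n * (q - x)\<rfloor> mod int n \<noteq> int n - 1"
      using good by fastforce
  qed
  ultimately show ?thesis by blast
qed

text \<open>At a level \<open>n \<le> 5\<close> the bound \<open>5 * card F < n\<close> would force \<open>Q\<close> to be empty; at level \<open>6\<close>
  it puts \<open>Q\<close> into a single ball. The lower levels are settled by the choice of the first interval, which
  makes all \<open>q - x\<close> smaller than \<open>1 / 5!\<close>, so that their digits up to \<open>5\<close> vanish.\<close>

lemma thin_set_in_translate_C0:
  fixes Q :: "real set"
  assumes thin: "\<And>n. 6 \<le> n \<Longrightarrow>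
    \<exists>F. finite F \<and> 5 * card F < n \<and> Q \<subseteq> (\<Union>p\<in>F. cball p (1 / fact n))"
  shows "\<exists>x. Q \<subseteq> (\<lambda>c. c + x) ` C0"
proof -
  from thin[of 6] obtain F where F: "finite F" "card F \<le> 1"
    and QF: "Q \<subseteq> (\<Union>p\<in>F. cball p (1 / fact 6))" by auto
  obtain p where "F \<subseteq> {p}"
    using F by (metis One_nat_def card_le_Suc0_iff_eq insert_iff subsetI)
  with QF have Qp: "\<bar>q - p\<bar> \<le> 1 / fact 6" if "q \<in> Q" for q
    using that by (force simp: dist_real_def abs_minus_commute)
  define I where "I k a = {a..a + 2 / fact (k + 6)}" for k and a :: real
  \<comment> \<open>For \<open>x\<close> in \<open>[p - 3 / 6!, p - 1 / 6!]\<close> every \<open>q - x\<close> lies in \<open>[0, 4 / 6!]\<close>: it is nonnegative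
    and its digit with index \<open>6\<close> is at most \<open>4\<close>.\<close>
  define a0 where "a0 = p - 3 / fact 6"
  have "\<exists>a. \<forall>k. (k = 0 \<longrightarrow> a k = a0) \<and>
      (I (Suc k) (a (Suc k)) \<subseteq> I k (a k) \<and>
        (\<forall>x\<in>I (Suc k) (a (Suc k)). avoids_top_digit (k + 7) Q x))"
  proof (rule dependent_nat_choice)
    fix a :: real and k :: nat
    obtain G where "finite G" "5 * card G < k + 7" "Q \<subseteq> (\<Union>p\<in>G. cball p (1 / fact (k + 7)))"
      using thin[of "k + 7"] by auto
    moreover have "k + 7 - 1 = k + 6" "Suc k + 6 = k + 7" by simp_all
    ultimately show "\<exists>a'. (Suc k = 0 \<longrightarrow> a' = a0) \<and> I (Suc k) a' \<subseteq> I k a \<and>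
        (\<forall>x\<in>I (Suc k) a'. avoids_top_digit (k + 7) Q x)"
      using refine_interval[of "k + 7" G Q a] unfolding I_def
      by (metis add_is_0 gr0I nat.distinct(1) zero_neq_numeral)
  qed simp
  then obtain a where a0: "a 0 = a0"
    and nested: "\<And>k. I (Suc k) (a (Suc k)) \<subseteq> I k (a k)"
    and avoid: "\<And>k x. x \<in> I (Suc k) (a (Suc k)) \<Longrightarrow> avoids_top_digit (k + 7) Q x"
    by blast
  have "(\<Inter>k. I k (a k)) \<noteq> {}"
  proof (rule compact_nest)
    show "compact (I k (a k))" "I k (a k) \<noteq> {}" for k
      by (auto simp: I_def)
    show "I n (a n) \<subseteq> I m (a m)" if "m \<le> n" for m n
      using lift_Suc_antimono_le[of "\<lambda>k. I k (a k)", OF nested that] .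
  qed
  then obtain x where x: "\<And>k. x \<in> I k (a k)" by blast
  have "q - x \<in> C0" if "q \<in> Q" for q
  proof (rule mem_C0_if_digits)
    let ?y = "q - x"
    have "x \<le> p - 1 / fact 6" "p - 3 / fact 6 \<le> x"
      using x[of 0] by (auto simp: I_def a0 a0_def field_simps)
    with Qp[OF that] have y: "0 \<le> ?y" "?y \<le> 4 / fact 6"
      unfolding abs_le_iff by (auto simp: fact_numeral)
    then show "0 \<le> ?y" "?y < 1" by (auto simp: fact_numeral)
    show "\<lfloor>fact n * ?y\<rfloor> mod int n \<noteq> int n - 1" if "n \<ge> 2" for n
    proof (cases "n \<le> 6")
      case True
      then consider "n \<le> 5" | "n = 6" by linarith
      then show ?thesis
      proof cases
        case 1
        have "(fact n :: real) \<le> fact 5" using 1 by (rule fact_mono)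
        then have "fact n * ?y \<le> fact 5 * (4 / fact 6)"
          using y by (intro mult_mono) auto
        then have "\<lfloor>fact n * ?y\<rfloor> = 0"
          using y by (auto simp: floor_eq_iff fact_numeral)
        with that show ?thesis by simp
      next
        case 2
        have "0 \<le> fact n * ?y" "fact n * ?y \<le> 4"
          using y 2 by (auto simp: fact_numeral)
        then have "0 \<le> \<lfloor>fact n * ?y\<rfloor>" "\<lfloor>fact n * ?y\<rfloor> \<le> 4"
          by linarith+
        moreover from this have "\<lfloor>fact n * ?y\<rfloor> mod int n = \<lfloor>fact n * ?y\<rfloor>"
          using 2 by (intro mod_pos_pos_trivial) auto
        ultimately show ?thesis using 2 by linarith
      qed
    next
      case False
      then have "Suc (n - 7) + 6 = n" "(n - 7) + 7 = n" by auto
      with avoid[OF x[of "Suc (n - 7)"]] \<open>q \<in> Q\<close> show ?thesis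
        by (simp add: avoids_top_digit_def)
    qed
  qed
  then have "q \<in> (\<lambda>c. c + x) ` C0" if "q \<in> Q" for q
    using that by (intro image_eqI[of _ _ "q - x"]) auto
  then show ?thesis by blast
qed

section \<open>Thin perfect subsets\<close>

text \<open>The new point with number \<open>k + 1\<close> is attached to the earlier one with number
  \<open>fst (prod_decode k) \<le> k\<close>. Every index \<open>i\<close> is of this form for arbitrarily large \<open>k\<close>, so each point
  receives infinitely many new neighbours.\<close>

function branching_seq :: "('a \<Rightarrow> nat \<Rightarrow> 'a) \<Rightarrow> 'a \<Rightarrow> nat \<Rightarrow> 'a" where
  "branching_seq h p 0 = p"
| "branching_seq h p (Suc k) = h (branching_seq h p (fst (prod_decode k))) k"
  by pat_completeness auto

lemma fst_prod_decode_le: "fst (prod_decode k) \<le> k"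
  by (metis le_prod_encode_1 prod.collapse prod_decode_inverse)

termination
  by (relation "Wellfounded.measure (\<lambda>(h, p, k). k)") (auto simp: fst_prod_decode_le less_Suc_eq_le)

lemma uncountable_perfect:
  fixes S :: "'a::complete_space set"
  assumes "closed S" "S \<noteq> {}" "\<And>x. x \<in> S \<Longrightarrow> x islimpt S"
  shows "uncountable S"
proof -
  have "euclidean derived_set_of S = {x. x islimpt S}"
    unfolding derived_set_of_def islimpt_def by auto
  also have "\<dots> = S"
    using assms by (auto simp: closed_limpt)
  finally have "(UNIV::real set) \<lesssim> S"
    using lepoll_perfect_set completely_metrizable_space_euclidean assms(2) by blast
  then show ?thesis
    using countable_lepoll uncountable_UNIV_real by blast
qed

lemma closure_no_isolated:
  fixes D :: "'a::t1_space set"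
  assumes "\<And>x. x \<in> D \<Longrightarrow> x islimpt D" "x \<in> closure D"
  shows "x islimpt closure D"
  using assms by (auto simp: closure_def intro: islimpt_subset)

text \<open>The subset is the closure of a sequence whose point number \<open>k + 1\<close> is within \<open>\<epsilon> k / 2 ^ (k + 1)\<close>
  of an earlier point. Points with numbers beyond \<open>k\<close> then stay within \<open>\<epsilon> k\<close> of the first \<open>k + 1\<close>
  points, as the displacements along a chain of ancestors sum up to less than \<open>\<epsilon> k\<close>; this survives
  taking the closure, since finitely many closed balls have a closed union. Each point of the
  sequence is approached by its own neighbours, so the closure has no isolated points.\<close>

lemma thin_perfect_subset:
  fixes P :: "'a::complete_space set" and \<epsilon> :: "nat \<Rightarrow> real"
  assumes P: "closed P" "P \<noteq> {}" "\<And>p. p \<in> P \<Longrightarrow> p islimpt P"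
    and \<epsilon>: "decseq \<epsilon>" "\<And>k. 0 < \<epsilon> k"
  shows "\<exists>Q\<subseteq>P. uncountable Q \<and>
    (\<forall>k. \<exists>F. finite F \<and> card F \<le> k + 1 \<and> Q \<subseteq> (\<Union>p\<in>F. cball p (\<epsilon> k)))"
proof -
  define \<delta> where "\<delta> k = \<epsilon> k / 2 ^ Suc k" for k
  have \<delta>_pos: "0 < \<delta> k" for k by (simp add: \<delta>_def \<epsilon>)
  have "\<forall>p k. \<exists>y. p \<in> P \<longrightarrow> y \<in> P \<and> y \<noteq> p \<and> dist y p < \<delta> k"
    using P(3) \<delta>_pos by (meson islimpt_approachable)
  then obtain h where h: "\<And>p k. p \<in> P \<Longrightarrow> h p k \<in> P \<and> h p k \<noteq> p \<and> dist (h p k) p < \<delta> k"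
    by metis
  obtain p0 where p0: "p0 \<in> P" using P(2) by blast
  define q where "q = branching_seq h p0"
  define g where "g k = fst (prod_decode k)" for k
  have g_le: "g k \<le> k" for k by (simp add: g_def fst_prod_decode_le)
  have q_Suc: "q (Suc k) = h (q (g k)) k" for k by (simp add: q_def g_def)
  have qP: "q k \<in> P" for k
  proof (induction k rule: less_induct)
    case (less k)
    then show ?case
      using p0 h g_le by (cases k) (auto simp: q_Suc less_Suc_eq_le q_def[THEN fun_cong, of 0])
  qed
  \<comment> \<open>The factor \<open>1 - 1 / 2 ^ n\<close> leaves room for the next displacement.\<close>
  have near: "\<exists>i\<le>k. dist (q n) (q i) \<le> \<epsilon> k * (1 - 1 / 2 ^ n)" for k n
  proof (induction n rule: less_induct)
    case (less n)
    show ?case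
    proof (cases "n \<le> k")
      case True
      have "0 \<le> \<epsilon> k * (1 - 1 / 2 ^ n)" using \<epsilon>(2)[of k] by (simp add: field_simps)
      with True show ?thesis by (intro exI[of _ n]) simp
    next
      case False
      then obtain m where m: "n = Suc m" "k \<le> m" by (cases n) auto
      have "g m < n" using g_le[of m] m by simp
      from less.IH[OF this] obtain i where i: "i \<le> k" "dist (q (g m)) (q i) \<le> \<epsilon> k * (1 - 1 / 2 ^ g m)"
        by blast
      have "(2::real) ^ g m \<le> 2 ^ m" using g_le[of m] by simp
      then have "(1::real) / 2 ^ m \<le> 1 / 2 ^ g m" by (simp add: frac_le)
      then have "\<epsilon> k * (1 - 1 / 2 ^ g m) \<le> \<epsilon> k * (1 - 1 / 2 ^ m)"
        using \<epsilon>(2)[of k] by (intro mult_left_mono) auto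
      moreover have "dist (q n) (q (g m)) \<le> \<delta> m"
        using h[OF qP[of "g m"], of m] m by (simp add: q_Suc)
      moreover have "\<delta> m \<le> \<epsilon> k / 2 ^ Suc m"
        unfolding \<delta>_def using \<epsilon>(1) m(2) by (intro divide_right_mono) (auto dest: decseqD)
      ultimately have "dist (q n) (q i) \<le> \<epsilon> k * (1 - 1 / 2 ^ m) + \<epsilon> k / 2 ^ Suc m"
        using i(2) dist_triangle[of "q n" "q i" "q (g m)"] by linarith
      also have "\<dots> = \<epsilon> k * (1 - 1 / 2 ^ n)" by (simp add: m field_simps)
      finally show ?thesis using i(1) by blast
    qed
  qed
  define Q where "Q = closure (range q)"
  have "\<delta> \<longlonglongrightarrow> 0"
  proof (rule tendsto_sandwich[OF _ _ tendsto_const])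
    show "\<forall>\<^sub>F k in sequentially. 0 \<le> \<delta> k" using \<delta>_pos by (simp add: less_imp_le)
    have "\<delta> k \<le> \<epsilon> 0 * (1 / 2) ^ Suc k" for k
      unfolding \<delta>_def power_one_over using \<epsilon>(1) by (simp add: divide_right_mono decseqD)
    then show "\<forall>\<^sub>F k in sequentially. \<delta> k \<le> \<epsilon> 0 * (1 / 2) ^ Suc k" by simp
    show "(\<lambda>k. \<epsilon> 0 * (1 / 2) ^ Suc k) \<longlonglongrightarrow> 0"
      by (rule tendsto_mult_right_zero[OF LIMSEQ_Suc[OF LIMSEQ_power_zero]]) simp
  qed
  have "q i islimpt range q" for i
    unfolding islimpt_approachable
  proof (intro allI impI)
    fix e :: real assume "0 < e"
    with \<open>\<delta> \<longlonglongrightarrow> 0\<close> have "\<forall>\<^sub>F k in sequentially. \<delta> k < e" by (rule order_tendstoD)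
    then obtain b where b: "\<And>k. b \<le> k \<Longrightarrow> \<delta> k < e"
      by (auto simp: eventually_sequentially)
    define k where "k = prod_encode (i, b)"
    have "g k = i" by (simp add: g_def k_def)
    moreover have "\<delta> k < e" by (rule b) (simp add: k_def le_prod_encode_2)
    ultimately have "q (Suc k) \<noteq> q i \<and> dist (q (Suc k)) (q i) < e"
      using h[OF qP[of i], of k] by (simp add: q_Suc)
    then show "\<exists>x'\<in>range q. x' \<noteq> q i \<and> dist x' (q i) < e" by blast
  qed
  then have "x islimpt Q" if "x \<in> Q" for x
    using that closure_no_isolated[of "range q" x] unfolding Q_def by blast
  then have "uncountable Q"
    by (intro uncountable_perfect) (auto simp: Q_def)
  moreover have "Q \<subseteq> P"
    unfolding Q_def using qP P(1) by (intro closure_minimal) auto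
  moreover have "\<exists>F. finite F \<and> card F \<le> k + 1 \<and> Q \<subseteq> (\<Union>p\<in>F. cball p (\<epsilon> k))" for k
  proof (intro exI conjI)
    show "finite (q ` {..k})" by simp
    show "card (q ` {..k}) \<le> k + 1" using card_image_le[of "{..k}" q] by simp
    show "Q \<subseteq> (\<Union>p\<in>q ` {..k}. cball p (\<epsilon> k))"
      unfolding Q_def
    proof (rule closure_minimal)
      show "range q \<subseteq> (\<Union>p\<in>q ` {..k}. cball p (\<epsilon> k))"
      proof
        fix y assume "y \<in> range q"
        then obtain n where n: "y = q n" by blast
        obtain i where "i \<le> k" "dist (q n) (q i) \<le> \<epsilon> k * (1 - 1 / 2 ^ n)" using near by blast
        moreover have "\<epsilon> k * (1 - 1 / 2 ^ n) \<le> \<epsilon> k" using \<epsilon>(2)[of k] by (simp add: field_simps)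
        ultimately show "y \<in> (\<Union>p\<in>q ` {..k}. cball p (\<epsilon> k))"
          unfolding n by (force simp: dist_commute)
      qed
    qed auto
  qed
  ultimately show ?thesis by blast
qed

theorem theorem0p2:
  fixes P :: "real set"
  assumes "perfect_set P"
  shows "\<exists>x::real. uncountable ((\<lambda>c. c + x) ` C0 \<inter> P)"
proof -
  \<comment> \<open>The \<open>k + 1\<close> balls of radius \<open>\<epsilon> k\<close> serve the five levels \<open>n = 5 k + 6, ..., 5 k + 10\<close>: they satisfy
    \<open>5 (k + 1) < n\<close>, and the radius is the one for the last of them.\<close>
  define \<epsilon> :: "nat \<Rightarrow> real" where "\<epsilon> k = 1 / fact (5 * k + 10)" for k
  have "decseq \<epsilon>"
    unfolding decseq_def \<epsilon>_def by (intro allI impI divide_left_mono fact_mono) auto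
  moreover have "p islimpt P" if "p \<in> P" for p
    using assms that by (auto simp: perfect_set_def isolated_in_islimpt_iff)
  moreover have "P \<noteq> {}" "closed P" using assms by (auto simp: perfect_set_def)
  ultimately obtain Q where Q: "Q \<subseteq> P" "uncountable Q"
    and cover: "\<And>k. \<exists>F. finite F \<and> card F \<le> k + 1 \<and> Q \<subseteq> (\<Union>p\<in>F. cball p (\<epsilon> k))"
    using thin_perfect_subset[of P \<epsilon>] by (auto simp: \<epsilon>_def)
  have "\<exists>F. finite F \<and> 5 * card F < n \<and> Q \<subseteq> (\<Union>p\<in>F. cball p (1 / fact n))" if n: "6 \<le> n" for n
  proof -
    define k where "k = (n - 6) div 5"
    have k: "5 * (k + 1) < n" "n \<le> 5 * k + 10" using n unfolding k_def by presburger+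
    obtain F where F: "finite F" "card F \<le> k + 1" "Q \<subseteq> (\<Union>p\<in>F. cball p (\<epsilon> k))"
      using cover by blast
    have "\<epsilon> k \<le> 1 / fact n"
      unfolding \<epsilon>_def using k(2) by (intro divide_left_mono fact_mono) auto
    then have "Q \<subseteq> (\<Union>p\<in>F. cball p (1 / fact n))"
      using F(3) subset_cball by blast
    moreover have "5 * card F < n" using mult_le_mono2[OF F(2), of 5] k(1) by (rule le_less_trans)
    ultimately show ?thesis using F(1) by blast
  qed
  from thin_set_in_translate_C0[OF this] obtain x where "Q \<subseteq> (\<lambda>c. c + x) ` C0" by blast
  with Q show ?thesis by (meson Int_greatest countable_subset)
qed

end
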